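(* For every $\sigma\ge0$, the level spacing distribution for the desymmetrized Robin spectrum on the unit square $\Omega=[0,1]^2$ is a delta-function at the origin. That is, if $\lambda_0^\sigma\le\lambda_1^\sigma\le\dots$ denote the ordered desymmetrized Robin eigenvalues, then for all $y>0$, $$\lim_{N\to\infty}\frac1N\#\Big\{n\le N:\ \frac12\,\frac{\mathrm{area}(\Omega)}{4\pi}\,(\lambda_{n+1}^\sigma-\lambda_n^\sigma)\le y\Big\}=1 .$$
   Context: The Robin problem on the square is $-\Delta f=\lambda f$ on $\Omega=[0,1]^2$, $\frac{\partial f}{\partial n}+\sigma f=0$ on $\partial\Omega$ (outward normal derivative; $\sigma=0$ is Neumann). By separation of variables its eigenvalues are $\Lambda_{m,n}(\sigma)=k_m(\sigma)^2+k_n(\sigma)^2$, $m,n\ge0$, where $k_n(0)=n\pi$ and, for $\sigma>0$, $k_n(\sigma)$ is the unique solution in $(n\pi,(n+1)\pi)$ of the secular equation $(k^2-\sigma^2)\sin k=2k\sigma\cos k$. Since $\Lambda_{m,n}=\Lambda_{n,m}$, the desymmetrized Robin spectrum consists only of the $\Lambda_{m,n}(\sigma)$ with $0\le m\le n$ (each such pair counted once), arranged in nondecreasing order. Level spacing distribution: for a sequence $x_0\le x_1\le\dots$ with $x_N=cN+o(N)$, put $\delta_n=(x_{n+1}-x_n)/c$; the level spacing distribution $P(s)$ is defined by $\int_0^yP(s)\,ds=\lim_{N\to\infty}\frac1N\#\{n\le N:\delta_n\le y\}$ (if the limit exists). Being a delta-function at the origin means this limit equals $1$ for every $y>0$. 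*)

theory Defs
  imports "HOL-Analysis.Analysis" "HOL-Library.Landau_Symbols"
begin

definition robin_secular :: "real \<Rightarrow> real \<Rightarrow> bool" where
  "robin_secular \<sigma> k \<longleftrightarrow> (k\<^sup>2 - \<sigma>\<^sup>2) * sin k = 2 * k * \<sigma> * cos k"

definition robin_k :: "real \<Rightarrow> nat \<Rightarrow> real" where
  "robin_k \<sigma> n =
     (if \<sigma> = 0 then real n * pi
      else (THE k. k \<in> {real n * pi <..< real (n + 1) * pi} \<and> robin_secular \<sigma> k))"

text \<open>
  A mode with \<open>k \<noteq> 0\<close> of the one-dimensional problem \<open>- u'' = k\<^sup>2 u\<close> on \<open>[0, 1]\<close> is, up to a factor,
  \<open>u x = k * cos (k * x) + \<sigma> * sin (k * x)\<close>.  It always satisfies the boundary condition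
  \<open>- u' 0 + \<sigma> * u 0 = 0\<close>, and the one at \<open>1\<close> is the secular equation.
\<close>

lemma robin_mode:
  fixes \<sigma> k :: real
  defines "u \<equiv> (\<lambda>x. k * cos (k * x) + \<sigma> * sin (k * x))"
    and "u' \<equiv> (\<lambda>x. k * (\<sigma> * cos (k * x) - k * sin (k * x)))"
  shows "(u has_real_derivative u' x) (at x)"
    and "(u' has_real_derivative - (k\<^sup>2 * u x)) (at x)"
    and "- u' 0 + \<sigma> * u 0 = 0"
    and "u' 1 + \<sigma> * u 1 = 0 \<longleftrightarrow> robin_secular \<sigma> k"
  unfolding u_def u'_def robin_secular_def
  by (auto intro!: derivative_eq_intros simp: algebra_simps power2_eq_square)

lemma robin_k_ex1:
  assumes "\<sigma> > 0"
  shows "\<exists>!k. k \<in> {real n * pi <..< real (n + 1) * pi} \<and> robin_secular \<sigma> k"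
proof -
  let ?a = "real n * pi" and ?b = "real (n + 1) * pi"
  define g where "g k = (k\<^sup>2 - \<sigma>\<^sup>2) * sin k - 2 * k * \<sigma> * cos k" for k
  define s where "s = (-1 :: real) ^ n"
  have ss: "s * s = 1" unfolding s_def by (simp flip: power_mult_distrib)
  have ab: "?a < ?b" by (simp add: distrib_right)
  have a0: "?a \<ge> 0" by simp
  have sinpos: "s * sin k > 0" if "k \<in> {?a<..<?b}" for k
  proof -
    have "sin (k - real n * pi) > 0"
      using that by (intro sin_gt_zero) (auto simp: algebra_simps)
    moreover have "sin (k - real n * pi) = s * sin k"
      by (simp add: sin_diff s_def cos_npi)
    ultimately show ?thesis by simp
  qed
  define h where "h k = cos k / sin k - (k\<^sup>2 - \<sigma>\<^sup>2) / (2 * k * \<sigma>)" for k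
  have h_eq: "robin_secular \<sigma> k \<longleftrightarrow> h k = 0" if "k \<in> {?a<..<?b}" for k
  proof -
    have "sin k \<noteq> 0" using sinpos[OF that] by auto
    moreover have "k > 0" using that le_less_trans[OF a0] by auto
    ultimately show ?thesis using assms
      unfolding robin_secular_def h_def by (auto simp: field_simps)
  qed
  have uniq: "k = l" if k: "k \<in> {?a<..<?b}" "h k = 0" and l: "l \<in> {?a<..<?b}" "h l = 0" for k l
  proof (rule ccontr)
    have main: "h y < h x" if x: "x \<in> {?a<..<?b}" and y: "y \<in> {?a<..<?b}" and "x < y" for x y
    proof (rule DERIV_neg_imp_decreasing[OF \<open>x < y\<close>])
      fix z assume "x \<le> z" "z \<le> y"
      then have z: "z \<in> {?a<..<?b}" using x y by auto
      then have s0: "sin z \<noteq> 0" using sinpos by force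
      have z0: "z > 0" using z le_less_trans[OF a0] by auto
      define A where "A = - sin z * sin z - cos z * cos z"
      define B where "B = 2 * z * (2 * z * \<sigma>) - (z\<^sup>2 - \<sigma>\<^sup>2) * (2 * \<sigma>)"
      define d where "d = A / (sin z * sin z) - B / ((2 * z * \<sigma>) * (2 * z * \<sigma>))"
      have "(h has_real_derivative d) (at z)"
        using s0 z0 assms unfolding h_def[abs_def] d_def A_def B_def
        by (auto intro!: derivative_eq_intros)
      moreover have "d < 0"
      proof -
        have "A = -1"
          using sin_cos_squared_add[of z] by (simp add: A_def power2_eq_square)
        moreover have "sin z * sin z > 0" using s0 by (auto simp: zero_less_mult_iff)
        ultimately have "A / (sin z * sin z) < 0" by (simp add: divide_neg_pos)
        moreover have "B = 2 * \<sigma> * (z\<^sup>2 + \<sigma>\<^sup>2)"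
          by (simp add: B_def algebra_simps power2_eq_square)
        then have "B / ((2 * z * \<sigma>) * (2 * z * \<sigma>)) > 0"
          using assms z0 by (simp add: add_pos_pos)
        ultimately show ?thesis unfolding d_def by linarith
      qed
      ultimately show "\<exists>d. (h has_real_derivative d) (at z) \<and> d < 0" by blast
    qed
    assume "k \<noteq> l"
    then show False using main[of k l] main[of l k] k l by linarith
  qed
  have "\<exists>k\<in>{?a<..<?b}. robin_secular \<sigma> k"
  proof -
    have cont: "continuous_on {x..y} (\<lambda>k. s * g k)" for x y
      unfolding g_def by (intro continuous_intros)
    have gb: "s * g ?b > 0"
    proof -
      have "sin ?b = 0" "cos ?b = - s"
        by (simp_all only: sin_npi cos_npi s_def) (simp_all)
      then have "s * g ?b = 2 * ?b * \<sigma> * (s * s)" unfolding g_def by simp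
      then show ?thesis using ss assms a0 ab by simp
    qed
    obtain c where c: "c \<in> {?a<..<?b}" "s * g c < 0"
    proof (cases n)
      case 0
      define c where "c = min (1::real) \<sigma>"
      have c: "c > 0" "c \<le> 1" "c \<le> \<sigma>" using assms by (auto simp: c_def)
      have pi: "c < pi / 2" using c pi_gt3 by linarith
      then have "cos c > 0" "sin c > 0" using c by (auto intro: cos_gt_zero sin_gt_zero)
      moreover have "c\<^sup>2 \<le> \<sigma>\<^sup>2" using c by (intro power_mono) auto
      ultimately have "(c\<^sup>2 - \<sigma>\<^sup>2) * sin c \<le> 0" "2 * c * \<sigma> * cos c > 0"
        using c assms by (auto simp: mult_nonpos_nonneg)
      then have "g c < 0" unfolding g_def by linarith
      then show ?thesis using that[of c] 0 c pi by (simp add: s_def)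
    next
      case (Suc m)
      have "s * g ?a < 0"
      proof -
        have "sin ?a = 0" "cos ?a = s" by (simp_all only: sin_npi cos_npi s_def)
        then have "s * g ?a = - (2 * ?a * \<sigma> * (s * s))" unfolding g_def by simp
        then show ?thesis using ss assms Suc by simp
      qed
      moreover have "isCont (\<lambda>k. s * g k) ?a" unfolding g_def by (intro continuous_intros)
      ultimately have "\<forall>\<^sub>F k in at ?a. s * g k < 0"
        unfolding isCont_def by (intro order_tendstoD(2))
      then have "\<forall>\<^sub>F k in at_right ?a. s * g k < 0"
        by (simp add: eventually_at_split)
      moreover have "\<forall>\<^sub>F k in at_right ?a. k \<in> {?a<..<?b}"
        using ab by (rule eventually_at_right_real)
      ultimately have "\<forall>\<^sub>F k in at_right ?a. k \<in> {?a<..<?b} \<and> s * g k < 0"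
        by eventually_elim simp
      then have "\<exists>k. k \<in> {?a<..<?b} \<and> s * g k < 0"
        by (rule eventually_happens'[rotated]) simp
      then show ?thesis using that by blast
    qed
    have "\<exists>x\<ge>c. x \<le> ?b \<and> s * g x = 0"
      using c gb cont by (intro IVT') auto
    then obtain x where x: "x \<ge> c" "x \<le> ?b" "s * g x = 0" by blast
    then have "x \<noteq> ?b" using gb by auto
    moreover have "g x = 0" using x(3) by (simp add: s_def)
    ultimately show ?thesis
      using x c by (intro bexI[of _ x]) (auto simp: g_def robin_secular_def)
  qed
  then show ?thesis using uniq h_eq by blast
qed

lemma robin_k_pos:
  assumes "\<sigma> > 0"
  shows "robin_k \<sigma> n \<in> {real n * pi <..< real (n + 1) * pi}"
    and "robin_secular \<sigma> (robin_k \<sigma> n)"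
  using theI'[OF robin_k_ex1[OF assms, of n]] assms by (simp_all add: robin_k_def)

definition robin_eigenvalue :: "real \<Rightarrow> nat \<times> nat \<Rightarrow> real" where
  "robin_eigenvalue \<sigma> = (\<lambda>(m, n). (robin_k \<sigma> m)\<^sup>2 + (robin_k \<sigma> n)\<^sup>2)"

text \<open>
  The bijection makes the enumeration count values with multiplicity: equal eigenvalues belonging
  to different pairs \<open>m \<le> n\<close> occur as separate entries of the sequence.
\<close>

definition ordered_desym_robin_spectrum :: "real \<Rightarrow> (nat \<Rightarrow> real) \<Rightarrow> bool" where
  "ordered_desym_robin_spectrum \<sigma> lam \<longleftrightarrow>
     mono lam \<and>
     (\<exists>e. bij_betw e UNIV {(m, n). m \<le> n} \<and> (\<forall>i. lam i = robin_eigenvalue \<sigma> (e i)))"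

lemma ordered_desym_robin_spectrum_exists:
  assumes "\<sigma> \<ge> 0"
  shows "\<exists>lam. ordered_desym_robin_spectrum \<sigma> lam"
proof -
  let ?S = "{(m, n). m \<le> (n :: nat)}"
  let ?f = "robin_eigenvalue \<sigma>"
  have k: "real n \<le> (robin_k \<sigma> n)\<^sup>2" for n
  proof -
    have "real n * pi \<le> robin_k \<sigma> n"
      using robin_k_pos(1)[of \<sigma> n] assms by (cases "\<sigma> = 0") (auto simp: robin_k_def)
    moreover have "real n * 1 \<le> real n * pi" using pi_gt3 by (intro mult_left_mono) auto
    ultimately have "(real n)\<^sup>2 \<le> (robin_k \<sigma> n)\<^sup>2" by (intro power_mono) auto
    moreover have "real n \<le> (real n)\<^sup>2" by (cases n) (auto simp: power2_eq_square)
    ultimately show ?thesis by linarith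
  qed
  have fin: "finite {p. ?f p \<le> x}" for x
  proof (rule finite_subset)
    show "{p. ?f p \<le> x} \<subseteq> {..nat \<lceil>x\<rceil>} \<times> {..nat \<lceil>x\<rceil>}"
    proof clarify
      fix m n assume "?f (m, n) \<le> x"
      then have "real m \<le> x" "real n \<le> x"
        using k[of m] k[of n] by (auto simp: robin_eigenvalue_def)
      then show "m \<in> {..nat \<lceil>x\<rceil>} \<and> n \<in> {..nat \<lceil>x\<rceil>}" by (auto; linarith)
    qed
  qed simp
  have inf: "infinite ?S"
  proof
    assume "finite ?S"
    then have "finite (snd ` ?S)" by simp
    moreover have "snd ` ?S = UNIV" by force
    ultimately show False by simp
  qed
  have "\<exists>e. \<forall>i::nat. e i \<in> ?S - e ` {..<i} \<and> (\<forall>q\<in>?S - e ` {..<i}. ?f (e i) \<le> ?f q)"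
  proof (rule dependent_wellorder_choice
      [where P = "\<lambda>e (i::nat) p. p \<in> ?S - e ` {..<i} \<and> (\<forall>q\<in>?S - e ` {..<i}. ?f p \<le> ?f q)"])
    fix r :: "nat \<times> nat" and e e' :: "nat \<Rightarrow> nat \<times> nat" and i
    assume "\<And>j. j < i \<Longrightarrow> e j = e' j"
    then have "e ` {..<i} = e' ` {..<i}" by (intro image_cong) auto
    then show "(r \<in> ?S - e ` {..<i} \<and> (\<forall>q\<in>?S - e ` {..<i}. ?f r \<le> ?f q)) =
        (r \<in> ?S - e' ` {..<i} \<and> (\<forall>q\<in>?S - e' ` {..<i}. ?f r \<le> ?f q))" by simp
  next
    fix i and e :: "nat \<Rightarrow> nat \<times> nat"
    let ?T = "?S - e ` {..<i}"
    have "infinite ?T" using inf by simp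
    then obtain p where p: "p \<in> ?T" by (metis ex_in_conv finite.emptyI)
    let ?U = "?T \<inter> {q. ?f q \<le> ?f p}"
    have U: "finite ?U" "?U \<noteq> {}" using fin p by auto
    then obtain r where r: "r \<in> ?U" "\<And>q. q \<in> ?U \<Longrightarrow> ?f r \<le> ?f q"
      using ex_is_arg_min_if_finite[OF U, of ?f] by (auto simp: is_arg_min_linorder)
    have "?f r \<le> ?f q" if "q \<in> ?T" for q
      using r that by (cases "?f q \<le> ?f p") auto
    then show "\<exists>r. r \<in> ?T \<and> (\<forall>q\<in>?T. ?f r \<le> ?f q)" using r(1) by blast
  qed
  then obtain e where e':
    "\<And>i::nat. e i \<in> ?S - e ` {..<i} \<and> (\<forall>q\<in>?S - e ` {..<i}. ?f (e i) \<le> ?f q)"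
    by auto
  have e1: "e i \<in> ?S" for i
    by (rule DiffD1[OF conjunct1[OF e'[of i]]])
  have e2: "e i \<notin> e ` {..<i}" for i
    using conjunct1[OF e'[of i]] by simp
  have e3: "?f (e i) \<le> ?f q" if "q \<in> ?S" "q \<notin> e ` {..<i}" for i q
    by (rule bspec[OF conjunct2[OF e'[of i]]]) (rule DiffI that)+
  have inj: "inj e"
  proof (rule injI)
    fix i j assume "e i = e j"
    then show "i = j" using e2[of i] e2[of j] by (metis imageI lessThan_iff linorder_neqE_nat)
  qed
  have "p \<in> range e" if p: "p \<in> ?S" for p
  proof (rule ccontr)
    assume "p \<notin> range e"
    have "?f (e i) \<le> ?f p" for i by (rule e3[OF p]) (use \<open>p \<notin> range e\<close> in auto)
    then have "range e \<subseteq> {q. ?f q \<le> ?f p}" by (intro image_subsetI CollectI)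
    then have "finite (range e)" by (rule finite_subset[OF _ fin])
    then show False using finite_imageD[OF _ inj] by simp
  qed
  then have "?S \<subseteq> range e" by (rule subsetI)
  moreover have "range e \<subseteq> ?S" by (rule image_subsetI) (rule e1)
  ultimately have "bij_betw e UNIV ?S" using inj unfolding bij_betw_def by simp
  moreover have "mono (\<lambda>i. ?f (e i))"
  proof (rule monoI)
    fix i j :: nat assume "i \<le> j"
    then have "e j \<notin> e ` {..<i}" using e2[of j] by auto
    then show "?f (e i) \<le> ?f (e j)" by (rule e3[OF e1])
  qed
  ultimately have "ordered_desym_robin_spectrum \<sigma> (\<lambda>i. ?f (e i))"
    unfolding ordered_desym_robin_spectrum_def by (intro conjI exI[of _ e] allI refl)
  then show ?thesis by (intro exI)
qed

text \<open>
  \<open>F\<close> is the cumulative function \<open>y \<mapsto> \<integral>\<^sub>0\<^sup>y P(s) ds\<close> of the distribution \<open>P\<close>, so that it also covers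
  measures without a density; the delta-function at the origin is \<open>F = (\<lambda>_. 1)\<close> on \<open>y > 0\<close>.
  The constant \<open>c\<close> is determined by the sequence; it has to be nonzero for \<open>\<delta>\<^sub>n\<close> to make sense.
\<close>

definition has_level_spacing :: "(nat \<Rightarrow> real) \<Rightarrow> (real \<Rightarrow> real) \<Rightarrow> bool" where
  "has_level_spacing x F \<longleftrightarrow>
     (\<exists>c > 0. (\<lambda>N. x N - c * real N) \<in> o(\<lambda>N. real N) \<and>
       (\<forall>y > 0. (\<lambda>N. real (card {n. n \<le> N \<and> (x (n + 1) - x n) / c \<le> y}) / real N) \<longlonglongrightarrow> F y))"

definition unit_square :: "(real \<times> real) set" where
  "unit_square = {0..1} \<times> {0..1}"

end

theory Submission
  imports Defs "HOL-Number_Theory.Residues" "HOL-Real_Asymp.Real_Asymp"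
begin

text \<open>
  The spectrum clusters at a set of density zero. As \<open>n\<close> grows, the gap between the Robin and the
  Neumann eigenvalue of the interval, \<open>(robin_k \<sigma> n)\<^sup>2 - (n * pi)\<^sup>2\<close>, tends to \<open>4 * \<sigma>\<close>
  (\<open>robin_neumann_gap_tendsto\<close>). Hence, given \<open>y > 0\<close>, the eigenvalue of \<open>(m, n)\<close> lies close to
  \<open>pi\<^sup>2 * (m\<^sup>2 + n\<^sup>2) + 8 * \<sigma>\<close> unless \<open>m\<close> or \<open>n\<close> is below a fixed bound, and the exceptional eigenvalues up
  to \<open>x\<close> are only \<open>O (sqrt x)\<close> in number. The eigenvalues belonging to one value \<open>s = m\<^sup>2 + n\<^sup>2\<close> thus form a
  cluster of diameter less than \<open>y\<close>, and only the last one in a cluster can be followed by a gap larger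
  than \<open>y\<close>. So the number of large gaps up to \<open>x\<close> is at most the number of sums of two squares up to
  \<open>x / pi\<^sup>2\<close>, plus \<open>O (sqrt x)\<close> (\<open>card_large_gaps_le\<close>). By Weyl's law \<open>lam N \<sim> 8 * pi * N\<close>
  (\<open>weyl_law\<close>, from Gauss's count of lattice points in a disc) it remains to see that sums of two
  squares have density zero (\<open>sums_of_two_squares_density_zero\<close>).

  For this, a prime \<open>p \<equiv> 3 (mod 4)\<close> never divides a sum of two squares exactly once. Sieving by
  finitely many such primes leaves a set of density \<open>\<Prod>p. 1 - 1 / p + 1 / p\<^sup>2\<close>, and these products become
  arbitrarily small because \<open>\<Sum>p. 1 / p\<close> over \<open>p \<equiv> 3 (mod 4)\<close> diverges. The latter case of
  Dirichlet's theorem is obtained in finite form (\<open>odd_harmonic_sum_le\<close>): the partial sums of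
  \<open>\<chi>(n) / n\<close> for the nonprincipal character \<open>\<chi>\<close> modulo \<open>4\<close> are bounded by \<open>1\<close>, and changing the sign
  of \<open>\<chi>\<close> at \<open>p\<close> increases the bound by the factor \<open>(1 + 1 / p) / (1 - 1 / p)\<close> only. Doing so for all
  primes \<open>p \<equiv> 3 (mod 4)\<close> up to \<open>X\<close> turns the sum up to \<open>X\<close> into the divergent odd harmonic sum.
\<close>

section \<open>Divergence over the primes congruent to 3 modulo 4\<close>

text \<open>
  The nonprincipal Dirichlet character modulo \<open>4\<close>.
\<close>

definition chi4 :: "nat \<Rightarrow> real" where
  "chi4 n = (if n mod 4 = 1 then 1 else if n mod 4 = 3 then -1 else 0)"

lemma chi4_mult: "chi4 (m * n) = chi4 m * chi4 n"
proof -
  have *: "m mod 4 \<in> {0,1,2,3}" "n mod 4 \<in> {0,1,2,3}" by auto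
  have "(m * n) mod 4 = (m mod 4) * (n mod 4) mod 4" by (simp add: mod_mult_eq)
  then show ?thesis using * unfolding chi4_def by auto
qed

text \<open>
  The nonzero terms alternate in sign and decrease in absolute value. The induction keeps track of
  the two phases: after a positive term at least \<open>1 / (X + 1)\<close> is left to absorb the next negative
  one, and after a negative term the sum is at most \<open>1 - 1 / (X + 1)\<close>, which leaves room for the next
  positive one.
\<close>

lemma chi4_partial_sums:
  "\<bar>\<Sum>n=1..X. chi4 n / real n\<bar> \<le> 1"
proof -
  let ?L = "\<lambda>X. \<Sum>n=1..X. chi4 n / real n"
  have step: "?L (Suc X) = ?L X + chi4 (Suc X) / real (Suc X)" for X by simp
  have dec: "1 / real (X + 2) \<le> 1 / real (X + 1)" for X by (simp add: field_simps)
  have inv: "(X mod 4 \<in> {1, 2} \<longrightarrow> 1 / real (X + 1) \<le> ?L X \<and> ?L X \<le> 1) \<and>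
        (X mod 4 \<in> {0, 3} \<longrightarrow> 0 \<le> ?L X \<and> ?L X \<le> 1 - 1 / real (X + 1))" for X
  proof (induction X)
    case (Suc X)
    have d: "1 / real (Suc X + 1) \<le> 1 / real (X + 1)" "0 \<le> 1 / real (X + 1)"
      using dec[of X] by simp_all
    have "X mod 4 \<in> {0, 1, 2, 3}" by auto
    then consider "X mod 4 = 0" | "X mod 4 = 1" | "X mod 4 = 2" | "X mod 4 = 3" by fast
    then show ?case
    proof cases
      case 1
      then have m: "Suc X mod 4 = 1" by (simp add: mod_Suc)
      then have "?L (Suc X) = ?L X + 1 / real (X + 1)" unfolding step by (simp add: chi4_def)
      then show ?thesis using Suc 1 m d by simp
    next
      case 2
      then have m: "Suc X mod 4 = 2" by (simp add: mod_Suc)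
      then have "?L (Suc X) = ?L X" unfolding step by (simp add: chi4_def)
      then show ?thesis using Suc 2 m d by simp
    next
      case 3
      then have m: "Suc X mod 4 = 3" by (simp add: mod_Suc)
      then have "?L (Suc X) = ?L X - 1 / real (X + 1)" unfolding step by (simp add: chi4_def)
      then show ?thesis using Suc 3 m d by simp
    next
      case 4
      then have m: "Suc X mod 4 = 0" by (simp add: mod_Suc)
      then have "?L (Suc X) = ?L X" unfolding step by (simp add: chi4_def)
      then show ?thesis using Suc 4 m d by simp
    qed
  qed simp
  have "X mod 4 \<in> {1, 2} \<or> X mod 4 \<in> {0, 3}" by auto
  moreover have "0 \<le> 1 / real (X + 1)" by simp
  ultimately show ?thesis using inv[of X] by linarith
qed

lemma sum_over_multiples:
  fixes h :: "nat \<Rightarrow> real"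
  assumes mult: "\<And>m n. m > 0 \<Longrightarrow> n > 0 \<Longrightarrow> h (m * n) = h m * h n" and p: "p > 0"
  shows "(\<Sum>n=1..X. h n / real n) =
    (\<Sum>n | n \<in> {1..X} \<and> \<not> p dvd n. h n / real n) + h p / real p * (\<Sum>n=1..X div p. h n / real n)"
proof -
  have im: "{n. n \<in> {1..X} \<and> p dvd n} = (\<lambda>n. p * n) ` {1..X div p}"
  proof (intro equalityI subsetI)
    fix n assume "n \<in> {n. n \<in> {1..X} \<and> p dvd n}"
    then obtain m where "n = p * m" "1 \<le> p * m" "p * m \<le> X" by auto
    then show "n \<in> (\<lambda>n. p * n) ` {1..X div p}"
      using p by (auto simp: less_eq_div_iff_mult_less_eq mult.commute)
  next
    fix n assume "n \<in> (\<lambda>n. p * n) ` {1..X div p}"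
    then show "n \<in> {n. n \<in> {1..X} \<and> p dvd n}"
      using p by (auto simp: less_eq_div_iff_mult_less_eq mult.commute)
  qed
  have "(\<Sum>n=1..X. h n / real n) =
      (\<Sum>n\<in>{n. n \<in> {1..X} \<and> \<not> p dvd n} \<union> {n. n \<in> {1..X} \<and> p dvd n}. h n / real n)"
    by (intro sum.cong) auto
  also have "\<dots> = (\<Sum>n | n \<in> {1..X} \<and> \<not> p dvd n. h n / real n) +
      (\<Sum>n | n \<in> {1..X} \<and> p dvd n. h n / real n)"
    by (intro sum.union_disjoint) auto
  also have "(\<Sum>n | n \<in> {1..X} \<and> p dvd n. h n / real n) = (\<Sum>n=1..X div p. h (p * n) / real (p * n))"
    unfolding im using p by (subst sum.reindex) (auto simp: inj_on_def)
  also have "\<dots> = (\<Sum>n=1..X div p. h p / real p * (h n / real n))"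
    using p by (intro sum.cong) (auto simp: mult)
  finally show ?thesis by (simp add: sum_distrib_left)
qed

text \<open>
  Replacing the value \<open>-1\<close> of a completely multiplicative function at one prime \<open>p\<close> by \<open>+1\<close>
  multiplies its Dirichlet series at \<open>1\<close> by the quotient \<open>(1 + 1/p) / (1 - 1/p)\<close> of Euler factors. For
  partial sums \<open>F\<close>, \<open>G\<close> of the old and the new series this reads
  \<open>G X - G (X div p) / p = F X + F (X div p) / p\<close>, both sides being the sum over the \<open>n\<close> prime to \<open>p\<close>.
  Thus a bound on all \<open>F X\<close> gives, by strong induction on \<open>X\<close>, a bound on all \<open>G X\<close>.
\<close>

lemma change_sign_at_prime:
  fixes f :: "nat \<Rightarrow> real"
  assumes mult: "\<And>m n. m > 0 \<Longrightarrow> n > 0 \<Longrightarrow> f (m * n) = f m * f n"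
    and p: "prime p" "f p = -1"
    and bound: "\<And>X. \<bar>\<Sum>n=1..X. f n / real n\<bar> \<le> M"
  defines "g \<equiv> \<lambda>n. f n * (-1) ^ multiplicity p n"
  shows "m > 0 \<Longrightarrow> n > 0 \<Longrightarrow> g (m * n) = g m * g n"
    and "g p = 1"
    and "\<not> p dvd n \<Longrightarrow> g n = f n"
    and "\<bar>\<Sum>n=1..X. g n / real n\<bar> \<le> M * ((1 + 1 / real p) / (1 - 1 / real p))"
proof -
  have p1: "p > 1" using p(1) by (rule prime_gt_1_nat)
  show multg: "g (m * n) = g m * g n" if "m > 0" "n > 0" for m n
    using that p(1)
    by (simp add: g_def mult prime_elem_multiplicity_mult_distrib power_add)
  show gp: "g p = 1" using p p1 by (simp add: g_def)
  show eq: "g n = f n" if "\<not> p dvd n" for n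
    using that by (simp add: g_def not_dvd_imp_multiplicity_0)
  show "\<bar>\<Sum>n=1..X. g n / real n\<bar> \<le> M * ((1 + 1 / real p) / (1 - 1 / real p))" for X
  proof (induction X rule: less_induct)
    case (less X)
    define K where "K = M * ((1 + 1 / real p) / (1 - 1 / real p))"
    have M0: "M \<ge> 0" using bound[of 0] by simp
    have rp: "0 < 1 / real p" "1 / real p < 1" using p1 by auto
    show ?case
    proof (cases "X = 0")
      case True
      then show ?thesis using M0 rp by simp
    next
      case False
      let ?F = "\<lambda>X. \<Sum>n=1..X. f n / real n" and ?G = "\<lambda>X. \<Sum>n=1..X. g n / real n"
      have F: "?F X = (\<Sum>n | n \<in> {1..X} \<and> \<not> p dvd n. f n / real n) + f p / real p * ?F (X div p)"
        using p1 by (intro sum_over_multiples mult) auto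
      have G: "?G X = (\<Sum>n | n \<in> {1..X} \<and> \<not> p dvd n. g n / real n) + g p / real p * ?G (X div p)"
        using p1 by (intro sum_over_multiples multg) auto
      have "(\<Sum>n | n \<in> {1..X} \<and> \<not> p dvd n. g n / real n) =
          (\<Sum>n | n \<in> {1..X} \<and> \<not> p dvd n. f n / real n)"
        by (intro sum.cong) (auto simp: eq)
      then have "?G X = ?F X + 1 / real p * ?F (X div p) + 1 / real p * ?G (X div p)"
        using F G p gp by simp
      then have "\<bar>?G X\<bar> \<le> \<bar>?F X\<bar> + \<bar>1 / real p * ?F (X div p)\<bar> + \<bar>1 / real p * ?G (X div p)\<bar>"
        by linarith
      also have "\<dots> = \<bar>?F X\<bar> + 1 / real p * \<bar>?F (X div p)\<bar> + 1 / real p * \<bar>?G (X div p)\<bar>"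
        unfolding abs_mult by simp
      also have "\<dots> \<le> M + 1 / real p * M + 1 / real p * K"
      proof (intro add_mono mult_left_mono bound)
        show "\<bar>?G (X div p)\<bar> \<le> K"
          unfolding K_def by (rule less) (use False p1 in simp)
      qed (use rp in simp_all)
      also have "\<dots> = K"
      proof -
        define u where "u = 1 / real p"
        have "u < 1" using rp by (simp add: u_def)
        then have "K * (1 - u) = M * (1 + u)" by (simp add: K_def u_def[symmetric])
        then show ?thesis unfolding u_def[symmetric] by (simp add: algebra_simps)
      qed
      finally show ?thesis by (simp add: K_def)
    qed
  qed
qed

definition primes_3_mod_4 :: "nat set" where
  "primes_3_mod_4 = {p. prime p \<and> p mod 4 = 3}"

lemma prime_3_mod_4_ge: "p \<in> primes_3_mod_4 \<Longrightarrow> p \<ge> 3"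
  using mod_less_eq_dividend[of p 4] by (auto simp: primes_3_mod_4_def)

text \<open>
  Starting from \<open>chi4\<close>, the signs at the primes of \<open>P\<close> are changed one after the other.
\<close>

lemma untwisted_character:
  assumes "finite P" "P \<subseteq> primes_3_mod_4"
  shows "\<exists>f :: nat \<Rightarrow> real. (\<forall>m n. m > 0 \<longrightarrow> n > 0 \<longrightarrow> f (m * n) = f m * f n) \<and> f 1 = 1 \<and>
    (\<forall>p. prime p \<longrightarrow> f p = (if p \<in> P then 1 else chi4 p)) \<and>
    (\<forall>X. \<bar>\<Sum>n=1..X. f n / real n\<bar> \<le> (\<Prod>p\<in>P. (1 + 1 / real p) / (1 - 1 / real p)))"
  using assms
proof (induction P rule: finite_induct)
  case empty
  show ?case
  proof (rule exI[of _ chi4], intro conjI allI impI)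
    show "chi4 1 = 1" by (simp add: chi4_def)
  qed (use chi4_partial_sums in \<open>simp_all add: chi4_mult\<close>)
next
  case (insert q P)
  then obtain f :: "nat \<Rightarrow> real"
    where mult: "\<And>m n. m > 0 \<Longrightarrow> n > 0 \<Longrightarrow> f (m * n) = f m * f n" and f1: "f 1 = 1"
      and fp: "\<And>p. prime p \<Longrightarrow> f p = (if p \<in> P then 1 else chi4 p)"
      and bound: "\<And>X. \<bar>\<Sum>n=1..X. f n / real n\<bar> \<le> (\<Prod>p\<in>P. (1 + 1 / real p) / (1 - 1 / real p))"
    by auto
  have q: "prime q" "q mod 4 = 3" using insert.prems by (auto simp: primes_3_mod_4_def)
  have fq: "f q = -1" using fp[OF q(1)] q insert.hyps by (simp add: chi4_def)
  define g where "g = (\<lambda>n. f n * (-1) ^ multiplicity q n)"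
  let ?M = "\<Prod>p\<in>P. (1 + 1 / real p) / (1 - 1 / real p)"
  have sign: "\<And>m n. m > 0 \<Longrightarrow> n > 0 \<Longrightarrow> g (m * n) = g m * g n" "g q = 1"
      "\<And>n. \<not> q dvd n \<Longrightarrow> g n = f n"
      "\<And>X. \<bar>\<Sum>n=1..X. g n / real n\<bar> \<le> ?M * ((1 + 1 / real q) / (1 - 1 / real q))"
    unfolding g_def by (rule change_sign_at_prime[of f q ?M, OF mult q(1) fq bound]; assumption)+
  show ?case
  proof (intro exI[of _ g] conjI allI impI)
    show "g (m * n) = g m * g n" if "m > 0" "n > 0" for m n using that by (rule sign(1))
    have "\<not> q dvd 1" using q(1) not_prime_1 by auto
    then show "g 1 = 1" using sign(3)[of 1] f1 by simp
    show "g p = (if p \<in> insert q P then 1 else chi4 p)" if "prime p" for p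
    proof (cases "p = q")
      case False
      then have "\<not> q dvd p" using that q(1) primes_dvd_imp_eq[of q p] by blast
      then show ?thesis using sign(3)[of p] fp[OF that] False by simp
    qed (use sign(2) in simp)
    show "\<bar>\<Sum>n=1..X. g n / real n\<bar> \<le> (\<Prod>p\<in>insert q P. (1 + 1 / real p) / (1 - 1 / real p))" for X
      using sign(4)[of X] insert.hyps by (simp add: mult.commute)
  qed
qed

text \<open>
  Once the sign has been changed at every prime \<open>p \<equiv> 3 (mod 4)\<close> up to \<open>X\<close>, the character is
  \<open>1\<close> at every odd \<open>n \<le> X\<close>, so that its sum is the odd harmonic sum.
\<close>

lemma odd_harmonic_sum_le:
  "(\<Sum>n | n \<in> {1..X} \<and> odd n. 1 / real n) \<le>
    (\<Prod>p\<in>primes_3_mod_4 \<inter> {..X}. (1 + 1 / real p) / (1 - 1 / real p))"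
proof -
  let ?P = "primes_3_mod_4 \<inter> {..X}"
  obtain f :: "nat \<Rightarrow> real"
    where mult: "\<And>m n. m > 0 \<Longrightarrow> n > 0 \<Longrightarrow> f (m * n) = f m * f n" and f1: "f 1 = 1"
      and fp: "\<And>p. prime p \<Longrightarrow> f p = (if p \<in> ?P then 1 else chi4 p)"
      and bound: "\<And>X. \<bar>\<Sum>n=1..X. f n / real n\<bar> \<le> (\<Prod>p\<in>?P. (1 + 1 / real p) / (1 - 1 / real p))"
    using untwisted_character[of ?P] by auto
  (* The value chi4 2 = 0 is untouched, so that f vanishes at all even numbers. *)
  have f2: "f 2 = 0"
    using fp[of 2] by (auto simp: chi4_def primes_3_mod_4_def)
  have feven: "f n = 0" if "even n" "n > 0" for n
    using that mult[of 2] f2 by (auto elim!: evenE)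
  have fodd: "f n = 1" if "odd n" "n \<le> X" for n
    using that
  proof (induction n rule: less_induct)
    case (less n)
    show ?case
    proof (cases "n = 1")
      case False
      then obtain p where p: "prime p" "p dvd n" using prime_factor_nat by blast
      then obtain m where m: "n = p * m" by auto
      have m0: "m > 0" "p > 1" using less.prems m p(1) by (auto intro: Nat.gr0I dest: prime_gt_1_nat)
      then have "m < n" "p \<le> n" using m by auto
      have "odd p" using less.prems m by auto
      then have "p mod 4 = 1 \<or> p mod 4 = 3" by presburger
      then have "f p = 1"
        using fp[OF p(1)] \<open>p \<le> n\<close> less.prems p(1) by (auto simp: primes_3_mod_4_def chi4_def)
      moreover have "f m = 1" using less.IH[of m] \<open>m < n\<close> less.prems m by auto
      ultimately show ?thesis using mult[of p m] m m0 by simp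
    qed (use f1 in simp)
  qed
  have "(\<Sum>n=1..X. f n / real n) = (\<Sum>n | n \<in> {1..X} \<and> odd n. 1 / real n)"
    by (rule sum.mono_neutral_cong_right) (use feven fodd in auto)
  then show ?thesis using bound[of X] by linarith
qed

lemma odd_harmonic_sum_ge:
  "harm X / 2 \<le> (\<Sum>n | n \<in> {1..2 * X} \<and> odd n. 1 / real n)"
proof -
  have "harm X / 2 = (\<Sum>k=1..X. 1 / real (2 * k))"
    by (simp add: harm_def sum_divide_distrib field_simps)
  also have "\<dots> \<le> (\<Sum>k=1..X. 1 / real (2 * k - 1))"
    by (intro sum_mono divide_left_mono) auto
  also have "\<dots> = (\<Sum>n\<in>(\<lambda>k. 2 * k - 1) ` {1..X}. 1 / real n)"
    by (subst sum.reindex) (auto simp: inj_on_def)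
  also have "\<dots> \<le> (\<Sum>n | n \<in> {1..2 * X} \<and> odd n. 1 / real n)"
    by (intro sum_mono2) auto
  finally show ?thesis .
qed

text \<open>
  The proportion of integers that no prime of \<open>P\<close> divides exactly once: the multiples of \<open>p\<close>
  have density \<open>1 / p\<close>, and those of \<open>p\<^sup>2\<close> return.
\<close>

definition sieve_density :: "nat set \<Rightarrow> real" where
  "sieve_density P = (\<Prod>p\<in>P. 1 - 1 / real p + 1 / (real p)\<^sup>2)"

text \<open>
  To first order in \<open>x\<close> both sides are \<open>exp (- 3 * x)\<close> and \<open>exp (- 2 * x)\<close>. The cube is chosen so
  that the comparison holds up to \<open>x = 1 / 3\<close>, the value for the smallest prime \<open>3\<close>.
\<close>

lemma sieve_factor_le:
  fixes x :: real
  assumes "0 \<le> x" "x \<le> 1 / 3"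
  shows "(1 - x + x\<^sup>2) ^ 3 \<le> (1 - x) / (1 + x)"
proof -
  (* The difference of the two sides after clearing the denominator, grouped into
     terms that are nonnegative on the range of x. *)
  have "(1 - x + x\<^sup>2) ^ 3 * (1 + x) + x * (1 - 3 * x) + x ^ 3 * ((1 - 3 * x\<^sup>2) + x * (1 - x ^ 3) + 2 * x ^ 3)
      = 1 - x"
    by (simp add: algebra_simps eval_nat_numeral)
  moreover have "x\<^sup>2 \<le> (1 / 3)\<^sup>2" "x ^ 3 \<le> 1"
    using assms by (auto intro!: power_mono power_le_one)
  then have "0 \<le> x ^ 3 * ((1 - 3 * x\<^sup>2) + x * (1 - x ^ 3) + 2 * x ^ 3)"
    using assms by (intro mult_nonneg_nonneg add_nonneg_nonneg) (auto simp: power2_eq_square)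
  moreover have "0 \<le> x * (1 - 3 * x)" using assms by simp
  ultimately have "(1 - x + x\<^sup>2) ^ 3 * (1 + x) \<le> 1 - x" by linarith
  then show ?thesis using assms by (simp add: pos_le_divide_eq)
qed

text \<open>
  The cube of the sieve density is at most the reciprocal of the product that dominates the odd
  harmonic sum, and that sum diverges.
\<close>

lemma sieve_density_small:
  assumes "\<epsilon> > 0"
  obtains P where "finite P" "P \<subseteq> primes_3_mod_4" "sieve_density P < \<epsilon>"
proof -
  have "eventually (\<lambda>X. harm X > 2 / \<epsilon> ^ 3) sequentially"
    using harm_at_top by (auto simp: filterlim_at_top_dense)
  then obtain X where X: "harm X > 2 / \<epsilon> ^ 3" by (auto simp: eventually_sequentially)
  define P where "P = primes_3_mod_4 \<inter> {..2 * X}"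
  define W where "W = (\<Prod>p\<in>P. (1 + 1 / real p) / (1 - 1 / real p))"
  have "1 / \<epsilon> ^ 3 < W"
    using X odd_harmonic_sum_ge[of X] odd_harmonic_sum_le[of "2 * X"] unfolding W_def P_def by linarith
  have "sieve_density P ^ 3 = (\<Prod>p\<in>P. (1 - 1 / real p + (1 / real p)\<^sup>2) ^ 3)"
    by (simp add: sieve_density_def prod_power_distrib power_divide)
  also have "\<dots> \<le> (\<Prod>p\<in>P. (1 - 1 / real p) / (1 + 1 / real p))"
  proof (intro prod_mono conjI sieve_factor_le zero_le_power)
    fix p assume "p \<in> P"
    then have p: "real p \<ge> 3" using prime_3_mod_4_ge[of p] by (auto simp: P_def)
    then show "1 / real p \<le> 1 / 3" by (simp add: field_simps)
    have "1 / real p \<le> 1" using p by simp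
    then show "0 \<le> 1 - 1 / real p + (1 / real p)\<^sup>2" by (intro add_nonneg_nonneg) auto
  qed auto
  also have "\<dots> = inverse W"
    unfolding W_def prod_inversef[symmetric] by (intro prod.cong) auto
  also have "\<dots> < \<epsilon> ^ 3"
    using \<open>1 / \<epsilon> ^ 3 < W\<close> assms by (simp add: field_simps less_trans[of 0 "1 / \<epsilon> ^ 3" W])
  finally have "sieve_density P < \<epsilon>"
    using power_less_imp_less_base[of "sieve_density P" 3 \<epsilon>] assms by simp
  then show thesis using that[of P] by (auto simp: P_def)
qed

section \<open>Sums of two squares have density zero\<close>

definition sifted :: "nat set \<Rightarrow> nat set" where
  "sifted P = {n. \<forall>p\<in>P. p dvd n \<longrightarrow> p\<^sup>2 dvd n}"

lemma sifted_mult_prime_iff: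
  assumes "prime q" "q \<notin> P" "\<And>p. p \<in> P \<Longrightarrow> prime p"
  shows "q * m \<in> sifted P \<longleftrightarrow> m \<in> sifted P"
proof -
  have "p dvd q * m \<longleftrightarrow> p dvd m" "p\<^sup>2 dvd q * m \<longleftrightarrow> p\<^sup>2 dvd m" if "p \<in> P" for p
  proof -
    have "coprime p q" using assms that by (intro primes_coprime) auto
    then show "p dvd q * m \<longleftrightarrow> p dvd m" "p\<^sup>2 dvd q * m \<longleftrightarrow> p\<^sup>2 dvd m"
      by (auto simp: coprime_dvd_mult_right_iff)
  qed
  then show ?thesis by (auto simp: sifted_def)
qed

text \<open>
  Sieving by a further prime \<open>q\<close> removes the multiples of \<open>q\<close> and restores those of \<open>q\<^sup>2\<close>. As
  multiplication by \<open>q\<close> preserves being sifted by \<open>P\<close>, both are counted by the old sieve at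
  \<open>X div q\<close> and at \<open>X div q div q\<close>.
\<close>

lemma card_sifted_insert:
  assumes q: "prime q" and P: "q \<notin> P" "\<And>p. p \<in> P \<Longrightarrow> prime p"
  shows "real (card (sifted (insert q P) \<inter> {1..X})) =
    real (card (sifted P \<inter> {1..X})) - (real (card (sifted P \<inter> {1..X div q}))
      - real (card (sifted P \<inter> {1..X div q div q})))"
proof -
  let ?A = "\<lambda>X. sifted P \<inter> {1..X}" and ?m = "\<lambda>n. q * n"
  have q0: "q > 0" using q by (simp add: prime_gt_0_nat)
  have inj: "inj_on ?m A" for A using q0 by (auto simp: inj_on_def)
  have scale: "q * m \<in> ?A X \<longleftrightarrow> m \<in> ?A (X div q)" for m X
  proof -
    have "q * m \<le> X \<longleftrightarrow> m \<le> X div q"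
      using q0 by (simp add: less_eq_div_iff_mult_less_eq mult.commute)
    moreover have "1 \<le> q * m \<longleftrightarrow> 1 \<le> m" using q0 by (simp add: Suc_le_eq)
    ultimately show ?thesis using sifted_mult_prime_iff[OF q P] by auto
  qed
  then have sub: "?m ` ?A (X div q) \<subseteq> ?A X" for X by blast
  have mem: "n \<in> ?m ` ?A (X div q) \<longleftrightarrow> n \<in> ?A X \<and> q dvd n" for n X
    unfolding image_iff dvd_def using scale by blast
  have "sifted (insert q P) \<inter> {1..X} = ?A X - (?m ` ?A (X div q) - ?m ` ?m ` ?A (X div q div q))"
  proof (rule Set.set_eqI)
    fix n
    have "n \<in> ?m ` ?m ` ?A (X div q div q) \<longleftrightarrow> (\<exists>m. n = q * m \<and> m \<in> ?A (X div q) \<and> q dvd m)"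
      using mem[of _ "X div q"] by blast
    also have "\<dots> \<longleftrightarrow> n \<in> ?A X \<and> (\<exists>m. n = q * m \<and> q dvd m)"
      using scale by blast
    also have "(\<exists>m. n = q * m \<and> q dvd m) \<longleftrightarrow> q\<^sup>2 dvd n"
      by (auto simp: power2_eq_square dvd_def mult.assoc)
    finally have "n \<in> ?m ` ?m ` ?A (X div q div q) \<longleftrightarrow> n \<in> ?A X \<and> q\<^sup>2 dvd n" .
    then show "n \<in> sifted (insert q P) \<inter> {1..X} \<longleftrightarrow>
        n \<in> ?A X - (?m ` ?A (X div q) - ?m ` ?m ` ?A (X div q div q))"
      using mem[of n X] by (auto simp: sifted_def)
  qed
  moreover have s1: "?m ` ?A (X div q) \<subseteq> ?A X" by (rule sub)
  moreover have s2: "?m ` ?m ` ?A (X div q div q) \<subseteq> ?m ` ?A (X div q)" by (intro image_mono sub)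
  have c: "card (?m ` A) = card A" for A by (intro card_image inj)
  have "card (?A X - (?m ` ?A (X div q) - ?m ` ?m ` ?A (X div q div q))) =
      card (?A X) - (card (?A (X div q)) - card (?A (X div q div q)))"
    using s1 s2 by (subst card_Diff_subset; (subst card_Diff_subset)?) (auto simp: c)
  moreover have "card (?A (X div q)) \<le> card (?A X)" using card_mono[OF _ s1] by (simp add: c)
  moreover have "card (?A (X div q div q)) \<le> card (?A (X div q))"
    using card_mono[OF _ s2] by (simp add: c)
  ultimately show ?thesis by (simp add: of_nat_diff)
qed

text \<open>
  The constant depends on \<open>P\<close> (the induction triples it at every prime, up to bounded terms). This
  suffices because \<open>P\<close> is chosen before \<open>X\<close> tends to infinity.
\<close>

lemma card_sifted_asymp:
  assumes "finite P" "\<And>p. p \<in> P \<Longrightarrow> prime p"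
  shows "\<exists>C. \<forall>X. \<bar>real (card (sifted P \<inter> {1..X})) - sieve_density P * real X\<bar> \<le> C"
  using assms
proof (induction P rule: finite_induct)
  case empty
  have "sifted {} = UNIV" by (auto simp: sifted_def)
  then show ?case by (intro exI[of _ 0]) (simp add: sieve_density_def)
next
  case (insert q P)
  then obtain C where C: "\<And>X. \<bar>real (card (sifted P \<inter> {1..X})) - sieve_density P * real X\<bar> \<le> C" by auto
  define c where "c X = real (card (sifted P \<inter> {1..X}))" for X
  define D where "D = \<bar>sieve_density P\<bar>"
  have q: "prime q" "\<And>p. p \<in> P \<Longrightarrow> prime p" using insert.prems by auto
  have div: "\<bar>c (X div k) - sieve_density P * (real X / real k)\<bar> \<le> C + D" for X k
  proof -
    have "\<bar>real (X div k) - real X / real k\<bar> \<le> 1"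
      using floor_divide_of_nat_eq[of X k, where ?'a = real] by linarith
    then have "\<bar>sieve_density P * (real (X div k) - real X / real k)\<bar> \<le> D * 1"
      unfolding D_def abs_mult by (intro mult_left_mono) auto
    then show ?thesis using C[of "X div k"] unfolding c_def by (simp add: right_diff_distrib)
  qed
  have dens: "sieve_density (insert q P) * real X = sieve_density P * real X -
      (sieve_density P * (real X / real q) - sieve_density P * (real X / real (q * q)))" for X
    using insert.hyps by (simp add: sieve_density_def field_simps power2_eq_square)
  have "\<bar>real (card (sifted (insert q P) \<inter> {1..X})) - sieve_density (insert q P) * real X\<bar> \<le> C + (C + D) + (C + D)" for X
    using C[of X] div[of X q] div[of X "q * q"] dens[of X]
      card_sifted_insert[OF q(1) insert.hyps(2) q(2), of X]
    unfolding c_def div_mult2_eq by linarith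
  then show ?case by blast
qed

text \<open>
  Otherwise \<open>p\<close> divides neither number. Raising \<open>a\<^sup>2 \<equiv> - b\<^sup>2\<close> to the odd power \<open>(p - 1) / 2\<close> then
  gives \<open>1 \<equiv> -1\<close> by Fermat's little theorem.
\<close>

lemma prime_3_mod_4_dvd_sum_two_squares:
  fixes a b :: nat
  assumes "p \<in> primes_3_mod_4" "p dvd a\<^sup>2 + b\<^sup>2"
  shows "p\<^sup>2 dvd a\<^sup>2 + b\<^sup>2"
proof -
  have p: "prime p" "p mod 4 = 3" "p \<ge> 3"
    using assms(1) prime_3_mod_4_ge by (auto simp: primes_3_mod_4_def)
  define k where "k = (p - 1) div 2"
  have k: "p - 1 = 2 * k" "odd k" using p(2) unfolding k_def by presburger+
  have "p dvd a"
  proof (rule ccontr)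
    assume a: "\<not> p dvd a"
    have b: "\<not> p dvd b"
    proof
      assume "p dvd b"
      then have "p dvd b\<^sup>2" by (simp add: power2_eq_square)
      then have "p dvd a\<^sup>2" using assms(2) by (simp add: dvd_add_left_iff)
      then show False using a p(1) prime_dvd_power_nat by blast
    qed
    have "[(int a)\<^sup>2 = - (int b)\<^sup>2] (mod int p)"
      using assms(2) by (simp add: cong_iff_dvd_diff flip: of_nat_power of_nat_add)
    then have "[((int a)\<^sup>2) ^ k = (- (int b)\<^sup>2) ^ k] (mod int p)" by (rule cong_pow)
    then have 1: "[int a ^ (p - 1) = - (int b ^ (p - 1))] (mod int p)"
      using k by (simp add: power_mult)
    have f: "[int c ^ (p - 1) = 1] (mod int p)" if "\<not> p dvd c" for c
      using fermat_theorem[OF p(1) that] cong_int_iff[of "c ^ (p - 1)" 1 p] by simp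
    have "[1 = - 1] (mod int p)"
      using f[OF a] f[OF b] 1 by (meson cong_minus_minus_iff cong_sym cong_trans)
    then have "int p dvd 2" by (simp add: cong_iff_dvd_diff)
    then have "int p \<le> 2" by (rule zdvd_imp_le) simp
    then show False using p(3) by simp
  qed
  moreover then have "p dvd b"
  proof -
    have "p dvd a\<^sup>2" using \<open>p dvd a\<close> by (simp add: power2_eq_square)
    then have "p dvd b\<^sup>2" using assms(2) by (simp add: dvd_add_right_iff)
    then show ?thesis using p(1) prime_dvd_power_nat by blast
  qed
  ultimately show ?thesis by (intro dvd_add dvd_power_same) 
qed

definition sums_of_two_squares :: "nat set" where
  "sums_of_two_squares = {a\<^sup>2 + b\<^sup>2 | a b. True}"

text \<open>
  Sums of two squares survive the sieve by every finite set of primes \<open>p \<equiv> 3 (mod 4)\<close>, so their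
  upper density is at most every sieve density.
\<close>

lemma sums_of_two_squares_density_zero:
  "(\<lambda>X. real (card (sums_of_two_squares \<inter> {..X})) / real X) \<longlonglongrightarrow> 0"
proof (rule LIMSEQ_I)
  fix r :: real assume r: "r > 0"
  obtain P where P: "finite P" "P \<subseteq> primes_3_mod_4" "sieve_density P < r / 2"
    using sieve_density_small[of "r / 2"] r by auto
  obtain C where C: "\<And>X. \<bar>real (card (sifted P \<inter> {1..X})) - sieve_density P * real X\<bar> \<le> C"
    using card_sifted_asymp[of P] P by (auto simp: primes_3_mod_4_def)
  have sub: "sums_of_two_squares \<subseteq> sifted P"
    using P(2) prime_3_mod_4_dvd_sum_two_squares
    by (auto simp: sums_of_two_squares_def sifted_def)
  obtain N :: nat where N: "real N > 2 * (C + 1) / r" using reals_Archimedean2 by blast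
  show "\<exists>no. \<forall>n\<ge>no. norm (real (card (sums_of_two_squares \<inter> {..n})) / real n - 0) < r"
  proof (intro exI allI impI)
    fix X assume "X \<ge> max 1 N"
    then have X: "X \<ge> 1" "X \<ge> N" by auto
    have "card (sums_of_two_squares \<inter> {..X}) \<le> card (insert 0 (sifted P \<inter> {1..X}))"
      using sub by (intro card_mono) auto
    also have "\<dots> \<le> Suc (card (sifted P \<inter> {1..X}))" by (simp add: card_insert_if)
    finally have "real (card (sums_of_two_squares \<inter> {..X})) \<le> 1 + real (card (sifted P \<inter> {1..X}))" by simp
    also have "\<dots> \<le> 1 + C + sieve_density P * real X" using C[of X] by linarith
    also have "\<dots> < r / 2 * real X + r / 2 * real X"
    proof (intro add_strict_mono)
      have "2 * (C + 1) / r < real X" using N X by simp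
      then show "1 + C < r / 2 * real X" using r by (simp add: field_simps)
    qed (use P X in auto)
    finally show "norm (real (card (sums_of_two_squares \<inter> {..X})) / real X - 0) < r"
      using X r by (simp add: field_simps)
  qed
qed

section \<open>The gap between Robin and Neumann eigenvalues\<close>

text \<open>
  With \<open>k = n * pi + t\<close> the secular equation says \<open>(k\<^sup>2 - \<sigma>\<^sup>2) * sin t = 2 * k * \<sigma> * cos t\<close>. For
  \<open>k > \<sigma>\<close> this makes \<open>cos t\<close> positive, so \<open>t\<close> lies in \<open>(0, pi / 2)\<close>, on the branch of \<open>arctan\<close>.
\<close>

lemma robin_k_eq_arctan:
  assumes "\<sigma> > 0" "real n * pi > \<sigma>"
  shows "robin_k \<sigma> n = real n * pi + arctan (2 * robin_k \<sigma> n * \<sigma> / ((robin_k \<sigma> n)\<^sup>2 - \<sigma>\<^sup>2))"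
proof -
  define k where "k = robin_k \<sigma> n"
  define t where "t = k - real n * pi"
  have t: "0 < t" "t < pi" and sec: "(k\<^sup>2 - \<sigma>\<^sup>2) * sin k = 2 * k * \<sigma> * cos k"
    using robin_k_pos[OF assms(1), of n] by (auto simp: t_def k_def robin_secular_def algebra_simps)
  have "k > \<sigma>" using t assms(2) by (simp add: t_def)
  then have d: "k\<^sup>2 - \<sigma>\<^sup>2 > 0" using assms(1) by (simp add: power_strict_mono)
  have k: "k = t + real n * pi" by (simp add: t_def)
  have "sin k = (-1) ^ n * sin t" "cos k = (-1) ^ n * cos t"
    unfolding k by (simp_all add: sin_add cos_add)
  then have eq: "(k\<^sup>2 - \<sigma>\<^sup>2) * sin t = 2 * k * \<sigma> * cos t" using sec by simp
  have s: "sin t > 0" using t by (intro sin_gt_zero)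
  then have "0 < 2 * k * \<sigma> * cos t" using d unfolding eq[symmetric] by simp
  then have c: "cos t > 0" using \<open>k > \<sigma>\<close> assms(1) by (intro zero_less_mult_pos[of "2 * k * \<sigma>" "cos t"]) auto
  have "t < pi / 2"
  proof (rule ccontr)
    assume "\<not> t < pi / 2"
    then have "cos t \<le> cos (pi / 2)" using t by (subst cos_mono_le_eq) auto
    then show False using c by simp
  qed
  moreover have "tan t = 2 * k * \<sigma> / (k\<^sup>2 - \<sigma>\<^sup>2)"
    using eq d c by (simp add: tan_def field_simps)
  ultimately have "arctan (2 * k * \<sigma> / (k\<^sup>2 - \<sigma>\<^sup>2)) = t" using t by (intro arctan_unique) auto
  then show ?thesis unfolding k_def[symmetric] by (simp add: t_def)
qed

lemma robin_k_ge: "\<sigma> \<ge> 0 \<Longrightarrow> real n * pi \<le> robin_k \<sigma> n"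
  using robin_k_pos(1)[of \<sigma> n] by (cases "\<sigma> = 0") (auto simp: robin_k_def)

text \<open>
  For \<open>\<sigma> > 0\<close>, writing \<open>T\<close> for the arctangent in the preceding formula, the gap is
  \<open>2 * k * T - T\<^sup>2\<close>, and \<open>T \<sim> 2 * \<sigma> / k\<close>.
\<close>

lemma robin_neumann_gap_tendsto:
  assumes "\<sigma> \<ge> 0"
  shows "(\<lambda>n. (robin_k \<sigma> n)\<^sup>2 - (real n * pi)\<^sup>2) \<longlonglongrightarrow> 4 * \<sigma>"
proof (cases "\<sigma> = 0")
  case True
  then show ?thesis by (simp add: robin_k_def)
next
  case False
  then have \<sigma>: "\<sigma> > 0" using assms by simp
  have npi: "filterlim (\<lambda>n. real n * pi) at_top sequentially" by real_asymp
  have k: "filterlim (robin_k \<sigma>) at_top sequentially"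
    by (rule filterlim_at_top_mono[OF npi]) (simp add: robin_k_ge[OF assms])
  define T where "T k = arctan (2 * k * \<sigma> / (k\<^sup>2 - \<sigma>\<^sup>2))" for k
  have "((\<lambda>k. 2 * k * T k - (T k)\<^sup>2) \<longlongrightarrow> 4 * \<sigma>) at_top"
    unfolding T_def using \<sigma> by real_asymp
  then have "(\<lambda>n. 2 * robin_k \<sigma> n * T (robin_k \<sigma> n) - (T (robin_k \<sigma> n))\<^sup>2) \<longlonglongrightarrow> 4 * \<sigma>"
    by (rule filterlim_compose[OF _ k])
  moreover have "eventually (\<lambda>n. real n * pi > \<sigma>) sequentially"
    using npi by (auto simp: filterlim_at_top_dense)
  then have "eventually (\<lambda>n. 2 * robin_k \<sigma> n * T (robin_k \<sigma> n) - (T (robin_k \<sigma> n))\<^sup>2 =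
      (robin_k \<sigma> n)\<^sup>2 - (real n * pi)\<^sup>2) sequentially"
  proof eventually_elim
    case (elim n)
    have "real n * pi = robin_k \<sigma> n - T (robin_k \<sigma> n)"
      using robin_k_eq_arctan[OF \<sigma> elim] by (simp add: T_def)
    then show ?case by (simp only:) (simp add: power2_eq_square algebra_simps)
  qed
  ultimately show ?thesis by (rule Lim_transform_eventually)
qed

section \<open>Lattice points in a disc\<close>

text \<open>
  The area of the part of the quarter unit disc with abscissa at most \<open>u\<close>, which is the primitive
  of \<open>u \<mapsto> sqrt (1 - u\<^sup>2)\<close> that vanishes at \<open>0\<close>.
\<close>

definition circle_primitive :: "real \<Rightarrow> real" where
  "circle_primitive u = (u * sqrt (1 - u\<^sup>2) + arcsin u) / 2"

text \<open>
  The mean value theorem, the derivative \<open>sqrt (1 - u\<^sup>2)\<close> being decreasing. It is applied on the open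
  interval because \<open>arcsin\<close> has no finite derivative at \<open>1\<close>.
\<close>

lemma circle_primitive_diff_bounds:
  assumes "0 \<le> a" "a \<le> b" "b \<le> 1"
  shows "(b - a) * sqrt (1 - b\<^sup>2) \<le> circle_primitive b - circle_primitive a"
    and "circle_primitive b - circle_primitive a \<le> (b - a) * sqrt (1 - a\<^sup>2)"
proof -
  have "(b - a) * sqrt (1 - b\<^sup>2) \<le> circle_primitive b - circle_primitive a \<and>
      circle_primitive b - circle_primitive a \<le> (b - a) * sqrt (1 - a\<^sup>2)"
  proof (cases "a = b")
    case False
    have deriv: "(circle_primitive has_real_derivative sqrt (1 - z\<^sup>2)) (at z)" if "a < z" "z < b" for z
    proof -
      have "z\<^sup>2 < 1" using that assms by (simp add: power_less_one_iff abs_square_less_1)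
      then have p: "1 - z\<^sup>2 > 0" by simp
      define w where "w = sqrt (1 - z\<^sup>2)"
      have w: "w > 0" "w\<^sup>2 = 1 - z\<^sup>2" using p by (auto simp: w_def)
      have "(circle_primitive has_real_derivative
          (w + z * (- (2 * z) * (inverse w / 2)) + inverse w) / 2) (at z)"
        unfolding circle_primitive_def[abs_def] w_def using that assms p
        by (auto intro!: derivative_eq_intros simp: power2_eq_square)
      moreover have "(w + z * (- (2 * z) * (inverse w / 2)) + inverse w) / 2 = w"
        using w by (simp add: field_simps power2_eq_square)
      ultimately have "(circle_primitive has_real_derivative w) (at z)" by (simp only:)
      then show ?thesis by (simp only: w_def)
    qed
    have "continuous_on {a..b} circle_primitive"
      unfolding circle_primitive_def[abs_def] using assms by (intro continuous_intros) auto
    moreover have "circle_primitive differentiable (at z)" if "a < z" "z < b" for z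
      using deriv[OF that] real_differentiable_def by blast
    ultimately obtain l z where z: "a < z" "z < b" "DERIV circle_primitive z :> l"
        "circle_primitive b - circle_primitive a = (b - a) * l"
      using MVT[of a b circle_primitive] False assms by auto
    have l: "l = sqrt (1 - z\<^sup>2)" using deriv[OF z(1,2)] z(3) DERIV_unique by blast
    have "z\<^sup>2 \<le> b\<^sup>2" "a\<^sup>2 \<le> z\<^sup>2" using z(1,2) assms by (auto intro!: power_mono)
    then show ?thesis unfolding z(4) l using assms by (auto intro!: mult_left_mono)
  qed simp
  then show "(b - a) * sqrt (1 - b\<^sup>2) \<le> circle_primitive b - circle_primitive a"
    and "circle_primitive b - circle_primitive a \<le> (b - a) * sqrt (1 - a\<^sup>2)" by auto
qed

lemma circle_primitive_sum_bounds:
  assumes "0 \<le> h" "real K * h \<le> 1"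
  shows "(\<Sum>m=1..K. h * sqrt (1 - (real m * h)\<^sup>2)) \<le> circle_primitive (real K * h)"
    and "circle_primitive (real K * h) \<le> (\<Sum>m<K. h * sqrt (1 - (real m * h)\<^sup>2))"
  using assms(2)
proof (induction K)
  case (Suc K)
  have le: "real K * h \<le> real (Suc K) * h" using assms(1) by (simp add: algebra_simps)
  have diff: "real (Suc K) * h - real K * h = h" by (simp add: algebra_simps)
  note b = circle_primitive_diff_bounds[OF _ le, unfolded diff]
  {
    case 1
    then show ?case using Suc(1) le b(1) assms(1) by simp
  next
    case 2
    then show ?case using Suc(2) le b(2) assms(1) by simp
  }
qed (simp_all add: circle_primitive_def)

text \<open>
  Riemann sums with mesh \<open>1 / R\<close> for the area \<open>pi / 4\<close> of the quarter disc. The interval from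
  \<open>K / R\<close> to \<open>1\<close> may be shorter than the mesh; its area is covered by the summand \<open>m = K\<close>.
\<close>

lemma sum_sqrt_bounds:
  assumes "R > 0"
  defines "K \<equiv> nat \<lfloor>R\<rfloor>"
  shows "pi / 4 * R\<^sup>2 \<le> (\<Sum>m\<le>K. sqrt (R\<^sup>2 - (real m)\<^sup>2))"
    and "(\<Sum>m\<le>K. sqrt (R\<^sup>2 - (real m)\<^sup>2)) \<le> pi / 4 * R\<^sup>2 + R"
proof -
  define h where "h = 1 / R"
  have h: "h > 0" "R * h = 1" using assms(1) by (auto simp: h_def)
  have K: "real K \<le> R" "R \<le> real K + 1" using assms(1) unfolding K_def by linarith+
  have Kh: "0 \<le> real K * h" "real K * h \<le> 1" using K(1) h assms(1) by (auto simp: h_def field_simps)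
  have scale: "sqrt (R\<^sup>2 - (real m)\<^sup>2) = R\<^sup>2 * (h * sqrt (1 - (real m * h)\<^sup>2))" for m
  proof -
    have "R\<^sup>2 - (real m)\<^sup>2 = R\<^sup>2 * (1 - (real m * h)\<^sup>2)"
      using assms(1) by (simp add: h_def field_simps)
    then show ?thesis using assms(1) h(2) by (simp add: real_sqrt_mult power2_eq_square)
  qed
  have one: "circle_primitive 1 = pi / 4" by (simp add: circle_primitive_def)
  let ?s = "\<lambda>m. h * sqrt (1 - (real m * h)\<^sup>2)"
  have eq: "(\<Sum>m\<le>K. sqrt (R\<^sup>2 - (real m)\<^sup>2)) = R\<^sup>2 * (\<Sum>m\<le>K. ?s m)"
    unfolding scale by (simp add: sum_distrib_left)
  have "circle_primitive 1 \<le> circle_primitive (real K * h) + (1 - real K * h) * sqrt (1 - (real K * h)\<^sup>2)"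
    using circle_primitive_diff_bounds(2)[of "real K * h" 1] Kh by simp
  also have "\<dots> \<le> (\<Sum>m<K. ?s m) + ?s K"
  proof (intro add_mono circle_primitive_sum_bounds(2) mult_right_mono)
    (* The last piece is at most one mesh wide, as R < K + 1. *)
    have "(R - real K) * h \<le> 1 * h" using K h(1) by (intro mult_right_mono) auto
    then show "1 - real K * h \<le> h" using h(2) by (simp add: left_diff_distrib)
  qed (use Kh h in \<open>auto simp: abs_square_le_1\<close>)
  also have "\<dots> = (\<Sum>m\<le>K. ?s m)" by (simp add: lessThan_Suc_atMost[symmetric])
  finally have "R\<^sup>2 * (pi / 4) \<le> R\<^sup>2 * (\<Sum>m\<le>K. ?s m)" unfolding one by (intro mult_left_mono) auto
  then show "pi / 4 * R\<^sup>2 \<le> (\<Sum>m\<le>K. sqrt (R\<^sup>2 - (real m)\<^sup>2))" unfolding eq by (simp add: mult.commute)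
  have "(\<Sum>m\<le>K. ?s m) = ?s 0 + (\<Sum>m=1..K. ?s m)"
    by (simp add: atMost_atLeast0 sum.atLeast_Suc_atMost)
  also have "\<dots> \<le> h + circle_primitive (real K * h)"
    using circle_primitive_sum_bounds(1)[of h K] h Kh by simp
  also have "circle_primitive (real K * h) \<le> circle_primitive 1"
    using circle_primitive_diff_bounds(1)[of "real K * h" 1] Kh by simp
  finally have "R\<^sup>2 * (\<Sum>m\<le>K. ?s m) \<le> R\<^sup>2 * (h + pi / 4)" unfolding one by (intro mult_left_mono) auto
  also have "R\<^sup>2 * (h + pi / 4) = pi / 4 * R\<^sup>2 + R"
    using h(2) by (simp add: power2_eq_square algebra_simps)
  finally show "(\<Sum>m\<le>K. sqrt (R\<^sup>2 - (real m)\<^sup>2)) \<le> pi / 4 * R\<^sup>2 + R" unfolding eq .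
qed

text \<open>
  The column with abscissa \<open>m\<close> contains \<open>\<lfloor>sqrt (R\<^sup>2 - m\<^sup>2)\<rfloor> + 1\<close> points, which is at least the height of
  the column and exceeds it by at most \<open>1\<close>.
\<close>

lemma card_lattice_points_quarter_disc:
  assumes "R > 0"
  defines "Q \<equiv> {(m, n). (real m)\<^sup>2 + (real n)\<^sup>2 \<le> R\<^sup>2}"
  shows "finite Q" and "pi / 4 * R\<^sup>2 \<le> real (card Q)" and "real (card Q) \<le> pi / 4 * R\<^sup>2 + 2 * R + 1"
proof -
  define K where "K = nat \<lfloor>R\<rfloor>"
  define s where "s m = sqrt (R\<^sup>2 - (real m)\<^sup>2)" for m :: nat
  have K: "m \<le> K \<longleftrightarrow> real m \<le> R" for m
    unfolding K_def using assms(1) by (simp add: le_nat_iff le_floor_iff)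
  have s0: "s m \<ge> 0" if "m \<le> K" for m
    using that K by (auto simp: s_def intro!: power_mono)
  have Q: "Q = Sigma {..K} (\<lambda>m. {..nat \<lfloor>s m\<rfloor>})"
  proof -
    have "(real m)\<^sup>2 + (real n)\<^sup>2 \<le> R\<^sup>2 \<longleftrightarrow> m \<le> K \<and> n \<le> nat \<lfloor>s m\<rfloor>" for m n
    proof (cases "m \<le> K")
      case True
      have "n \<le> nat \<lfloor>s m\<rfloor> \<longleftrightarrow> real n \<le> s m"
        using s0[OF True] by (simp add: le_nat_iff le_floor_iff)
      also have "\<dots> \<longleftrightarrow> (real n)\<^sup>2 \<le> R\<^sup>2 - (real m)\<^sup>2"
        unfolding s_def using real_le_rsqrt sqrt_ge_absD by fastforce
      finally show ?thesis using True by auto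
    next
      case False
      then have "(real m)\<^sup>2 > R\<^sup>2" using assms(1) K by (intro power_strict_mono) auto
      moreover have "(real n)\<^sup>2 \<ge> 0" by simp
      ultimately show ?thesis using False by linarith
    qed
    then show ?thesis by (auto simp: Q_def)
  qed
  show "finite Q" unfolding Q by auto
  have card: "real (card Q) = (\<Sum>m\<le>K. real (nat \<lfloor>s m\<rfloor>) + 1)" unfolding Q by (simp add: add.commute)
  have "(\<Sum>m\<le>K. s m) \<le> real (card Q)" unfolding card
    by (intro sum_mono) linarith
  then show "pi / 4 * R\<^sup>2 \<le> real (card Q)"
    using sum_sqrt_bounds(1)[OF assms(1)] unfolding s_def K_def by linarith
  have "real (card Q) \<le> (\<Sum>m\<le>K. s m + 1)" unfolding card
    using s0 by (intro sum_mono) auto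
  also have "\<dots> = (\<Sum>m\<le>K. s m) + real K + 1" by (simp add: sum.distrib)
  also have "\<dots> \<le> pi / 4 * R\<^sup>2 + R + R + 1"
    using sum_sqrt_bounds(2)[OF assms(1)] K[of K] unfolding s_def K_def by (intro add_mono) auto
  finally show "real (card Q) \<le> pi / 4 * R\<^sup>2 + 2 * R + 1" by simp
qed

text \<open>
  The quarter disc is the union of \<open>T\<close> and its mirror image, which overlap in \<open>O (sqrt x)\<close> diagonal
  points.
\<close>

lemma card_ordered_lattice_points:
  fixes x :: real
  assumes "x > 0"
  defines "T \<equiv> {(m, n). m \<le> n \<and> (real m)\<^sup>2 + (real n)\<^sup>2 \<le> x}"
  shows "finite T" and "pi / 8 * x \<le> real (card T)" and "real (card T) \<le> pi / 8 * x + 2 * sqrt x + 1"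
proof -
  define R where "R = sqrt x"
  have R: "R > 0" "R\<^sup>2 = x" using assms(1) by (auto simp: R_def)
  define Q where "Q = {(m, n). (real m)\<^sup>2 + (real n)\<^sup>2 \<le> R\<^sup>2}"
  note cQ = card_lattice_points_quarter_disc[OF R(1), folded Q_def]
  define D where "D = (\<lambda>m. (m, m)) ` {..nat \<lfloor>R\<rfloor>}"
  have TQ: "T \<subseteq> Q" by (auto simp: T_def Q_def R(2))
  show fin: "finite T" using cQ(1) TQ by (rule finite_subset[rotated])
  have inj: "inj_on prod.swap A" for A :: "(nat \<times> nat) set" by (auto simp: inj_on_def)
  have Qeq: "Q = T \<union> prod.swap ` T" by (auto simp: T_def Q_def R(2) image_iff)
  have "T \<inter> prod.swap ` T \<subseteq> D"
  proof
    fix p assume "p \<in> T \<inter> prod.swap ` T"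
    then obtain m where m: "p = (m, m)" "(real m)\<^sup>2 + (real m)\<^sup>2 \<le> R\<^sup>2" by (auto simp: T_def R(2))
    then have "(real m)\<^sup>2 \<le> R\<^sup>2" using zero_le_power2[of "real m"] by linarith
    then have "real m \<le> R" using R(1) by (simp add: power2_le_iff_abs_le)
    then show "p \<in> D" using m R(1) by (auto simp: D_def le_nat_iff le_floor_iff)
  qed
  then have "card (T \<inter> prod.swap ` T) \<le> card D" by (intro card_mono) (auto simp: D_def)
  also have "\<dots> \<le> nat \<lfloor>R\<rfloor> + 1" unfolding D_def using card_image_le[of "{..nat \<lfloor>R\<rfloor>}"] by simp
  finally have diag: "real (card (T \<inter> prod.swap ` T)) \<le> R + 1" using R(1) by linarith
  have "card Q + card (T \<inter> prod.swap ` T) = 2 * card T"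
    using card_Un_Int[of T "prod.swap ` T"] fin card_image[OF inj, of T] by (simp add: Qeq)
  then have "real (card Q) + real (card (T \<inter> prod.swap ` T)) = 2 * real (card T)"
    by (metis of_nat_add of_nat_mult of_nat_numeral)
  then show "pi / 8 * x \<le> real (card T)" "real (card T) \<le> pi / 8 * x + 2 * sqrt x + 1"
    using cQ(2,3) diag R by (auto simp: R_def[symmetric])
qed

section \<open>Weyl's law and the number of large gaps\<close>

locale robin_spectrum =
  fixes \<sigma> :: real and lam :: "nat \<Rightarrow> real" and e :: "nat \<Rightarrow> nat \<times> nat"
  assumes \<sigma>: "\<sigma> \<ge> 0" and mono: "mono lam"
    and e: "bij_betw e UNIV {(m, n). m \<le> n}"
    and lam: "\<And>i. lam i = robin_eigenvalue \<sigma> (e i)"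
begin

definition square_sum :: "nat \<Rightarrow> nat" where
  "square_sum i = (fst (e i))\<^sup>2 + (snd (e i))\<^sup>2"

definition neumann_shift :: "nat \<Rightarrow> real" where
  "neumann_shift m = (robin_k \<sigma> m)\<^sup>2 - (real m * pi)\<^sup>2"

lemma neumann_shift_nonneg: "neumann_shift m \<ge> 0"
  using robin_k_ge[OF \<sigma>, of m] by (auto simp: neumann_shift_def intro!: power_mono)

lemma eigenvalue_eq: "robin_eigenvalue \<sigma> (m, n) = pi\<^sup>2 * ((real m)\<^sup>2 + (real n)\<^sup>2) + neumann_shift m + neumann_shift n"
  by (simp add: robin_eigenvalue_def neumann_shift_def algebra_simps)

lemma lam_eq: "lam i = pi\<^sup>2 * real (square_sum i) + neumann_shift (fst (e i)) + neumann_shift (snd (e i))"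
  using eigenvalue_eq[of "fst (e i)" "snd (e i)"] by (simp add: lam square_sum_def)

lemma inj_e: "inj_on e A"
  using e by (meson bij_betw_imp_inj_on inj_on_subset subset_UNIV)

lemma e_le: "fst (e i) \<le> snd (e i)"
  using bij_betwE[OF e] by (auto simp: case_prod_beta)

lemma square_sum_le: "pi\<^sup>2 * real (square_sum i) \<le> lam i"
  using lam_eq[of i] neumann_shift_nonneg[of "fst (e i)"] neumann_shift_nonneg[of "snd (e i)"] by linarith

definition lattice_pairs :: "real \<Rightarrow> (nat \<times> nat) set" where
  "lattice_pairs x = {(m, n). m \<le> n \<and> (real m)\<^sup>2 + (real n)\<^sup>2 \<le> x}"

text \<open>
  The first \<open>N + 1\<close> eigenvalues belong to distinct lattice points: Robin eigenvalues are at least the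
  Neumann ones, so these points lie in the disc of squared radius \<open>W / pi\<^sup>2\<close>. The \<open>1\<close> of \<open>N + 1\<close>
  cancels the constant of the lattice point count.
\<close>

lemma index_le:
  assumes "lam N \<le> W" "W > 0"
  shows "real N \<le> W / (8 * pi) + 2 * sqrt W / pi"
proof -
  have "e i \<in> lattice_pairs (W / pi\<^sup>2)" if "i \<le> N" for i
  proof -
    have "pi\<^sup>2 * real (square_sum i) \<le> W" using square_sum_le[of i] monoD[OF mono that] assms(1) by linarith
    then show ?thesis using e_le[of i]
      by (simp add: lattice_pairs_def case_prod_beta square_sum_def pos_le_divide_eq mult.commute)
  qed
  then have "card (e ` {..N}) \<le> card (lattice_pairs (W / pi\<^sup>2))"
    using card_ordered_lattice_points(1)[of "W / pi\<^sup>2", folded lattice_pairs_def] assms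
    by (intro card_mono) auto
  then have "real N + 1 \<le> real (card (lattice_pairs (W / pi\<^sup>2)))"
    by (simp add: card_image[OF inj_e])
  also have "\<dots> \<le> pi / 8 * (W / pi\<^sup>2) + 2 * sqrt (W / pi\<^sup>2) + 1"
    using card_ordered_lattice_points(3)[of "W / pi\<^sup>2", folded lattice_pairs_def] assms by simp
  also have "\<dots> = W / (8 * pi) + 2 * sqrt W / pi + 1"
    by (simp add: real_sqrt_divide power2_eq_square)
  finally show ?thesis by simp
qed

text \<open>
  Robin eigenvalues exceed the Neumann ones by at most \<open>2 * C\<close>. Subtracting a further \<open>1\<close> makes the
  comparison with \<open>lam N\<close> strict, so that also in the presence of multiplicities only indices below
  \<open>N\<close> are counted.
\<close>

lemma index_ge:
  assumes C: "\<And>m. neumann_shift m \<le> C" and N: "lam N > 1 + 2 * C"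
  shows "(lam N - 1 - 2 * C) / (8 * pi) \<le> real N"
proof -
  define x where "x = (lam N - 1 - 2 * C) / pi\<^sup>2"
  have x: "x > 0" using N by (simp add: x_def)
  have "lattice_pairs x \<subseteq> e ` {..<N}"
  proof
    fix p assume p: "p \<in> lattice_pairs x"
    then have "p \<in> {(m, n). m \<le> n}" by (auto simp: lattice_pairs_def)
    then obtain i where i: "p = e i" using e by (metis bij_betw_imp_surj_on rangeE)
    have "real (square_sum i) \<le> x" using p unfolding i by (simp add: lattice_pairs_def case_prod_beta square_sum_def)
    then have "pi\<^sup>2 * real (square_sum i) \<le> lam N - 1 - 2 * C"
      by (simp add: x_def pos_le_divide_eq mult.commute)
    then have "lam i < lam N"
      using lam_eq[of i] C[of "fst (e i)"] C[of "snd (e i)"] by linarith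
    then have "i < N" using monoD[OF mono, of N i] by (meson leD leI)
    then show "p \<in> e ` {..<N}" using i by auto
  qed
  then have "card (lattice_pairs x) \<le> card (e ` {..<N})" by (intro card_mono) auto
  then have "real (card (lattice_pairs x)) \<le> real N" by (simp add: card_image[OF inj_e])
  then have "pi / 8 * x \<le> real N"
    using card_ordered_lattice_points(2)[OF x, folded lattice_pairs_def] by linarith
  then show ?thesis by (simp add: x_def power2_eq_square)
qed

lemma neumann_shift_tendsto: "neumann_shift \<longlonglongrightarrow> 4 * \<sigma>"
  using robin_neumann_gap_tendsto[OF \<sigma>] by (simp add: neumann_shift_def[abs_def])

lemma lam_at_top: "filterlim lam at_top sequentially"
proof (rule filterlim_at_top_gt[where c = 0, THEN iffD2], intro allI impI)
  fix W :: real assume "W > 0"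
  obtain N :: nat where N: "real N > W / (8 * pi) + 2 * sqrt W / pi" using reals_Archimedean2 by blast
  have "W \<le> lam n" if "n \<ge> N" for n
    using index_le[of n W] N that \<open>W > 0\<close> by (meson linear not_le of_nat_le_iff order_trans)
  then show "eventually (\<lambda>n. W \<le> lam n) sequentially" by (auto simp: eventually_sequentially)
qed

lemma weyl_law: "(\<lambda>N. lam N / real N) \<longlonglongrightarrow> 8 * pi"
proof -
  have "Bseq neumann_shift" using neumann_shift_tendsto convergentI convergent_imp_Bseq by blast
  then obtain C where "\<And>m. \<bar>neumann_shift m\<bar> \<le> C" by (auto simp: Bseq_def)
  then have C: "neumann_shift m \<le> C" for m by (meson abs_le_D1)
  have "(\<lambda>N. real N / lam N) \<longlonglongrightarrow> 1 / (8 * pi)"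
  proof (rule tendsto_sandwich)
    have "((\<lambda>y. (y - 1 - 2 * C) / (8 * pi) / y) \<longlongrightarrow> 1 / (8 * pi)) at_top"
      by (real_asymp, simp add: field_simps)
    then show "(\<lambda>N. (lam N - 1 - 2 * C) / (8 * pi) / lam N) \<longlonglongrightarrow> 1 / (8 * pi)"
      by (rule filterlim_compose[OF _ lam_at_top])
    have "((\<lambda>y. (y / (8 * pi) + 2 * sqrt y / pi) / y) \<longlongrightarrow> 1 / (8 * pi)) at_top"
      by (real_asymp, simp add: field_simps)
    then show "(\<lambda>N. (lam N / (8 * pi) + 2 * sqrt (lam N) / pi) / lam N) \<longlonglongrightarrow> 1 / (8 * pi)"
      by (rule filterlim_compose[OF _ lam_at_top])
    have ev: "eventually (\<lambda>N. lam N > max 0 (1 + 2 * C)) sequentially"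
      using lam_at_top unfolding filterlim_at_top_dense by blast
    show "eventually (\<lambda>N. (lam N - 1 - 2 * C) / (8 * pi) / lam N \<le> real N / lam N) sequentially"
      using ev
    proof eventually_elim
      case (elim N)
      then show ?case by (intro divide_right_mono index_ge C) auto
    qed
    show "eventually (\<lambda>N. real N / lam N \<le> (lam N / (8 * pi) + 2 * sqrt (lam N) / pi) / lam N) sequentially"
      using ev
    proof eventually_elim
      case (elim N)
      then show ?case by (intro divide_right_mono index_le) auto
    qed
  qed
  then have "(\<lambda>N. inverse (real N / lam N)) \<longlonglongrightarrow> inverse (1 / (8 * pi))" by (rule tendsto_inverse) simp
  then show ?thesis by simp
qed

definition large_gaps :: "real \<Rightarrow> nat \<Rightarrow> nat set" where
  "large_gaps y N = {n. n \<le> N \<and> y < lam (n + 1) - lam n}"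

text \<open>
  An eigenvalue with both indices at least \<open>K\<close> lies within \<open>2 * y / 5\<close> of \<open>pi\<^sup>2 * s + 8 * \<sigma>\<close> for a sum
  \<open>s\<close> of two squares. Two of them with the same \<open>s\<close> differ by at most \<open>4 * y / 5\<close>, so only the last
  one can be followed by a gap larger than \<open>y\<close>: there are at most as many such gaps as values of \<open>s\<close>.
  The eigenvalues with an index below \<open>K\<close> are the lattice points of a strip of width \<open>K\<close> and length
  \<open>sqrt (lam N)\<close>.
\<close>

lemma card_large_gaps_le:
  assumes K: "\<And>m. m \<ge> K \<Longrightarrow> \<bar>neumann_shift m - 4 * \<sigma>\<bar> \<le> y / 5" and y: "y > 0"
  shows "card (large_gaps y N) \<le>
    card (sums_of_two_squares \<inter> {..nat \<lfloor>lam N / pi\<^sup>2\<rfloor>}) + K * (nat \<lfloor>sqrt (lam N)\<rfloor> + 1)"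
proof -
  define A where "A = {n \<in> large_gaps y N. K \<le> fst (e n)}"
  define B where "B = {n \<in> large_gaps y N. fst (e n) < K}"
  have square_sum_le_lam: "pi\<^sup>2 * real (square_sum n) \<le> lam N" if "n \<in> large_gaps y N" for n
    using square_sum_le[of n] monoD[OF mono, of n N] that by (auto simp: large_gaps_def)
  have "inj_on square_sum A"
  proof (rule linorder_inj_onI)
    fix n n' assume nn: "n < n'" "n \<in> A" "n' \<in> A"
    have cl: "\<bar>lam i - (pi\<^sup>2 * real (square_sum i) + 8 * \<sigma>)\<bar> \<le> 2 * (y / 5)" if "i \<in> A" for i
    proof -
      have "K \<le> fst (e i)" "K \<le> snd (e i)" using that e_le[of i] by (auto simp: A_def)
      then show ?thesis using K[of "fst (e i)"] K[of "snd (e i)"] lam_eq[of i] by linarith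
    qed
    have "lam n + y < lam (n + 1)" using nn by (auto simp: A_def large_gaps_def)
    also have "\<dots> \<le> lam n'" using nn(1) by (intro monoD[OF mono]) simp
    finally have lt: "lam n + y < lam n'" .
    show "square_sum n \<noteq> square_sum n'"
    proof
      assume "square_sum n = square_sum n'"
      then show False using cl[OF nn(2)] cl[OF nn(3)] lt y by simp
    qed
  qed auto
  then have "card A = card (square_sum ` A)" by (simp add: card_image)
  also have "\<dots> \<le> card (sums_of_two_squares \<inter> {..nat \<lfloor>lam N / pi\<^sup>2\<rfloor>})"
  proof (intro card_mono subsetI)
    fix s assume "s \<in> square_sum ` A"
    then obtain n where n: "s = square_sum n" "n \<in> large_gaps y N" by (auto simp: A_def)
    then have "real s \<le> lam N / pi\<^sup>2" using square_sum_le_lam[OF n(2)] by (simp add: pos_le_divide_eq mult.commute)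
    then have "s \<le> nat \<lfloor>lam N / pi\<^sup>2\<rfloor>" by (simp add: le_nat_floor)
    then show "s \<in> sums_of_two_squares \<inter> {..nat \<lfloor>lam N / pi\<^sup>2\<rfloor>}"
      using n by (auto simp: sums_of_two_squares_def square_sum_def)
  qed simp
  finally have cA: "card A \<le> card (sums_of_two_squares \<inter> {..nat \<lfloor>lam N / pi\<^sup>2\<rfloor>})" .
  have "card B = card (e ` B)" by (simp add: card_image[OF inj_e])
  also have "\<dots> \<le> card ({..<K} \<times> {..nat \<lfloor>sqrt (lam N)\<rfloor>})"
  proof (intro card_mono subsetI)
    fix p assume "p \<in> e ` B"
    then obtain n where n: "p = e n" "n \<in> large_gaps y N" "fst (e n) < K" by (auto simp: B_def)
    have "(real (snd (e n)))\<^sup>2 \<le> real (square_sum n)" by (simp add: square_sum_def)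
    also have "\<dots> \<le> pi\<^sup>2 * real (square_sum n)"
      using pi_ge_two mult_right_mono[of 1 "pi\<^sup>2" "real (square_sum n)"] by (simp add: one_le_power)
    also have "\<dots> \<le> lam N" by (rule square_sum_le_lam[OF n(2)])
    finally have "snd (e n) \<le> nat \<lfloor>sqrt (lam N)\<rfloor>" by (simp add: le_nat_floor real_le_rsqrt)
    then show "p \<in> {..<K} \<times> {..nat \<lfloor>sqrt (lam N)\<rfloor>}" using n by (auto simp: mem_Times_iff)
  qed simp
  finally have cB: "card B \<le> K * (nat \<lfloor>sqrt (lam N)\<rfloor> + 1)" by (simp add: card_cartesian_product)
  have "large_gaps y N = A \<union> B" by (auto simp: A_def B_def)
  then have "card (large_gaps y N) \<le> card A + card B" by (simp add: card_Un_le)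
  then show ?thesis using add_mono[OF cA cB] by (rule order_trans)
qed

text \<open>
  Both terms of the preceding bound are \<open>o (lam N)\<close>, and \<open>lam N\<close> is of order \<open>N\<close>.
\<close>

lemma large_gaps_density_zero:
  assumes "y > 0"
  shows "(\<lambda>N. real (card (large_gaps y N)) / real N) \<longlonglongrightarrow> 0"
proof -
  obtain K where K: "\<And>m. m \<ge> K \<Longrightarrow> \<bar>neumann_shift m - 4 * \<sigma>\<bar> \<le> y / 5"
    using LIMSEQ_D[OF neumann_shift_tendsto, of "y / 5"] assms by (auto intro: less_imp_le)
  define b where "b X = real (card (sums_of_two_squares \<inter> {..X})) / real X" for X
  define X where "X N = nat \<lfloor>lam N / pi\<^sup>2\<rfloor>" for N
  have "filterlim (\<lambda>y. nat \<lfloor>y / pi\<^sup>2\<rfloor>) at_top at_top" by real_asymp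
  then have X: "filterlim X at_top sequentially"
    unfolding X_def by (rule filterlim_compose[OF _ lam_at_top])
  have b0: "(\<lambda>N. b (X N)) \<longlonglongrightarrow> 0"
    using filterlim_compose[OF sums_of_two_squares_density_zero X] by (simp add: b_def)
  have "((\<lambda>y. real K * (sqrt y + 1) / y) \<longlongrightarrow> 0) at_top" by real_asymp
  then have s0: "(\<lambda>N. real K * (sqrt (lam N) + 1) / lam N) \<longlonglongrightarrow> 0"
    by (rule filterlim_compose[OF _ lam_at_top])
  show ?thesis
  proof (rule tendsto_sandwich[OF _ _ tendsto_const])
    have "(\<lambda>N. (b (X N) / pi\<^sup>2 + real K * (sqrt (lam N) + 1) / lam N) * (lam N / real N))
        \<longlonglongrightarrow> (0 / pi\<^sup>2 + 0) * (8 * pi)"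
      by (intro tendsto_intros b0 s0 weyl_law) simp
    then show "(\<lambda>N. (b (X N) / pi\<^sup>2 + real K * (sqrt (lam N) + 1) / lam N) * (lam N / real N)) \<longlonglongrightarrow> 0"
      by simp
    have "eventually (\<lambda>N. X N > 0) sequentially" "eventually (\<lambda>N. lam N > 0) sequentially"
      using eventually_compose_filterlim[OF eventually_gt_at_top X]
        eventually_compose_filterlim[OF eventually_gt_at_top lam_at_top] by auto
    then show "eventually (\<lambda>N. real (card (large_gaps y N)) / real N \<le>
        (b (X N) / pi\<^sup>2 + real K * (sqrt (lam N) + 1) / lam N) * (lam N / real N)) sequentially"
    proof eventually_elim
      case (elim N)
      have "real (card (large_gaps y N)) \<le>
          real (card (sums_of_two_squares \<inter> {..X N}) + K * (nat \<lfloor>sqrt (lam N)\<rfloor> + 1))"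
        unfolding X_def of_nat_le_iff by (rule card_large_gaps_le[OF K assms])
      also have "\<dots> = b (X N) * real (X N) + real K * (real (nat \<lfloor>sqrt (lam N)\<rfloor>) + 1)"
        using elim(1) by (simp add: b_def distrib_left)
      also have "\<dots> \<le> b (X N) * (lam N / pi\<^sup>2) + real K * (sqrt (lam N) + 1)"
        using elim(2) by (intro add_mono mult_left_mono) (auto simp: b_def X_def)
      also have "\<dots> = (b (X N) / pi\<^sup>2 + real K * (sqrt (lam N) + 1) / lam N) * lam N"
        using elim(2) by (simp add: distrib_right)
      finally have "real (card (large_gaps y N)) / real N \<le>
          (b (X N) / pi\<^sup>2 + real K * (sqrt (lam N) + 1) / lam N) * lam N / real N"
        by (rule divide_right_mono) simp
      then show ?case by simp
    qed
  qed simp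
qed

lemma small_gaps_density_one:
  assumes "c > 0" "y > 0"
  shows "(\<lambda>N. real (card {n. n \<le> N \<and> c * (lam (n + 1) - lam n) \<le> y}) / real N) \<longlonglongrightarrow> 1"
proof -
  have card: "real (card {n. n \<le> N \<and> c * (lam (n + 1) - lam n) \<le> y}) =
      real N + 1 - real (card (large_gaps (y / c) N))" for N
  proof -
    have sub: "large_gaps (y / c) N \<subseteq> {..N}" by (auto simp: large_gaps_def)
    have "{n. n \<le> N \<and> c * (lam (n + 1) - lam n) \<le> y} = {..N} - large_gaps (y / c) N"
      using assms(1) by (auto simp: large_gaps_def pos_divide_less_eq mult.commute not_less)
    then show ?thesis
      using sub card_mono[OF _ sub] by (simp add: card_Diff_subset finite_subset[OF sub] of_nat_diff)
  qed
  have "(\<lambda>N. (real N + 1) / real N - real (card (large_gaps (y / c) N)) / real N) \<longlonglongrightarrow> 1 - 0"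
    using assms by (intro tendsto_diff large_gaps_density_zero) (real_asymp | simp)+
  then show ?thesis unfolding card by (simp add: diff_divide_distrib)
qed

end

theorem theorem1p8:
  fixes \<sigma> :: real and lam :: "nat \<Rightarrow> real"
  assumes "\<sigma> \<ge> 0"
    and "ordered_desym_robin_spectrum \<sigma> lam"
  shows "has_level_spacing lam (\<lambda>_. 1) \<and>
    (\<forall>y > 0. (\<lambda>N. real (card {n. n \<le> N \<and>
        1 / 2 * (measure lborel unit_square / (4 * pi)) * (lam (n + 1) - lam n) \<le> y}) / real N)
      \<longlonglongrightarrow> 1)"
proof -
  obtain e where e: "mono lam" "bij_betw e UNIV {(m, n). m \<le> n}"
      "\<And>i. lam i = robin_eigenvalue \<sigma> (e i)"
    using assms(2) by (auto simp: ordered_desym_robin_spectrum_def)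
  interpret robin_spectrum \<sigma> lam e by unfold_locales (use assms(1) e in auto)
  have "unit_square = cbox (0, 0) (1, 1)" by (simp add: unit_square_def cbox_Pair_eq)
  then have "measure lborel unit_square = measure lborel (cbox (0, 0) (1, 1) :: (real \<times> real) set)"
    by (rule arg_cong)
  also have "\<dots> = 1" by (simp only: content_Pair) simp
  finally have area: "measure lborel unit_square = 1" .
  have "(\<lambda>N. lam N - 8 * pi * real N) \<in> o(\<lambda>N. real N)"
  proof (rule smalloI_tendsto)
    have "(\<lambda>N. lam N / real N - 8 * pi) \<longlonglongrightarrow> 8 * pi - 8 * pi"
      by (intro tendsto_diff weyl_law tendsto_const)
    moreover have ev: "eventually (\<lambda>N. real N \<noteq> 0) sequentially"
      using eventually_gt_at_top[of 0] by eventually_elim simp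
    then have "eventually (\<lambda>N. lam N / real N - 8 * pi = (lam N - 8 * pi * real N) / real N) sequentially"
      by eventually_elim (simp add: diff_divide_distrib)
    ultimately show "(\<lambda>N. (lam N - 8 * pi * real N) / real N) \<longlonglongrightarrow> 0"
      using Lim_transform_eventually by fastforce
    show "eventually (\<lambda>N. real N \<noteq> 0) sequentially" by (rule ev)
  qed
  then have "has_level_spacing lam (\<lambda>_. 1)"
    unfolding has_level_spacing_def
    using small_gaps_density_one[of "1 / (8 * pi)"] by (intro exI[of _ "8 * pi"]) simp
  moreover have "\<forall>y > 0. (\<lambda>N. real (card {n. n \<le> N \<and>
        1 / 2 * (measure lborel unit_square / (4 * pi)) * (lam (n + 1) - lam n) \<le> y}) / real N)
      \<longlonglongrightarrow> 1"
    unfolding area by (intro allI impI small_gaps_density_one) simp_all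
  ultimately show ?thesis by blast
qed

end
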